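(* Let $P\subseteq\{0,1\}^r$ be a relation, let $D$ be a set, and suppose $P$ embeds into a relation $A\subseteq D^r$ that admits a Mal'tsev polymorphism. Then $P$ also embeds into a finite Abelian group, i.e. there exist a finite Abelian group $G$, an injective map $\tau:\{0,1\}\to G$ and a coset $C$ of a subgroup of $G^r$ with $C\cap\tau(\{0,1\})^r=\tau(P)$.
   Context: $P$ embeds into $A\subseteq D^r$ if there is an injective map $\sigma:\{0,1\}\to D$ such that $\sigma(P) = A\cap\sigma(\{0,1\})^r$ (with $\sigma$ applied componentwise). A Mal'tsev polymorphism of $A$ is a map $\varphi:D^3\to D$ with $\varphi(a,a,b)=\varphi(b,a,a)=b$ for all $a,b\in D$ such that applying $\varphi$ componentwise to any three tuples of $A$ yields a tuple of $A$. The set $D$ may be finite or infinite. *)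

theory Defs
  imports "HOL-Library.FuncSet" "HOL-Algebra.Product_Groups"
begin

text \<open>
  An \<open>r\<close>-tuple over \<open>D\<close> is an extensional function on \<open>{..<r}\<close>, so that
  \<open>tuples r (carrier G)\<close> is literally the carrier of the direct power
  \<open>product_group {..<r} (\<lambda>_. G)\<close>.
\<close>

abbreviation tuples :: "nat \<Rightarrow> 'a set \<Rightarrow> (nat \<Rightarrow> 'a) set" where
  "tuples r D \<equiv> {..<r} \<rightarrow>\<^sub>E D"

definition embeds :: "nat \<Rightarrow> (nat \<Rightarrow> nat) set \<Rightarrow> 'd set \<Rightarrow> (nat \<Rightarrow> 'd) set \<Rightarrow> bool" where
  "embeds r P D A \<longleftrightarrow>
     (\<exists>\<sigma> \<in> {0, 1} \<rightarrow> D. inj_on \<sigma> {0, 1} \<and>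
        compose {..<r} \<sigma> ` P = A \<inter> tuples r (\<sigma> ` {0, 1}))"

definition maltsev_polymorphism ::
    "nat \<Rightarrow> 'd set \<Rightarrow> (nat \<Rightarrow> 'd) set \<Rightarrow> ('d \<Rightarrow> 'd \<Rightarrow> 'd \<Rightarrow> 'd) \<Rightarrow> bool" where
  "maltsev_polymorphism r D A \<phi> \<longleftrightarrow>
     (\<forall>a\<in>D. \<forall>b\<in>D. \<forall>c\<in>D. \<phi> a b c \<in> D) \<and>
     (\<forall>a\<in>D. \<forall>b\<in>D. \<phi> a a b = b \<and> \<phi> b a a = b) \<and>
     (\<forall>x\<in>A. \<forall>y\<in>A. \<forall>z\<in>A. (\<lambda>i\<in>{..<r}. \<phi> (x i) (y i) (z i)) \<in> A)"

text \<open>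
  Every finite group has an isomorphic copy whose elements are natural numbers, so quantifying
  over groups with elements of type \<^typ>\<open>nat\<close> loses no generality.
\<close>

definition embeds_in_finite_abelian_group :: "nat \<Rightarrow> (nat \<Rightarrow> nat) set \<Rightarrow> bool" where
  "embeds_in_finite_abelian_group r P \<longleftrightarrow>
     (\<exists>(G :: nat monoid) H C.
        comm_group G \<and> finite (carrier G) \<and>
        subgroup H (product_group {..<r} (\<lambda>_. G)) \<and>
        C \<in> rcosets\<^bsub>product_group {..<r} (\<lambda>_. G)\<^esub> H \<and>
        embeds r P (carrier G) C)"

end

theory Submission
  imports Defs
begin

text \<open>
  A Mal'tsev operation generates, for every odd arity, a term \<open>t(x\<^sub>0, \<dots>, x\<^sub>2\<^sub>k)\<close> that
  is unchanged when two equal neighbouring arguments are cancelled. A word over \<open>{0, 1}\<close> without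
  equal neighbours has an alternating sum outside \<open>{0, 1}\<close> unless it is a single letter, so on
  Boolean words with alternating sum \<open>b \<in> {0, 1}\<close> these terms return \<open>b\<close>. Hence \<open>P\<close> contains
  every Boolean tuple in the affine lattice spanned by \<open>P\<close> in \<open>\<int>\<^sup>r\<close>. Subgroups of \<open>\<int>\<^sup>r\<close>
  are closed in the profinite topology, so reducing this lattice modulo a suitable \<open>N\<close> adds no
  Boolean tuple.
\<close>

section \<open>Cancellation terms\<close>

text \<open>Arguments are infinite sequences, so terms of every arity share one type and cancelling
  a pair is a shift.\<close>

definition del_pair :: "nat \<Rightarrow> (nat \<Rightarrow> 'a) \<Rightarrow> nat \<Rightarrow> 'a" where
  "del_pair j x = (\<lambda>n. if n < j then x n else x (n + 2))"

lemma del_pair_commute: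
  "j + 2 \<le> i \<Longrightarrow> del_pair j (del_pair i x) = del_pair (i - 2) (del_pair j x)"
  by (auto simp: del_pair_def fun_eq_iff)

lemma del_pair_nth: "del_pair (length u) (\<lambda>n. f ((u @ a # b # v) ! n)) = (\<lambda>n. f ((u @ v) ! n))"
  by (auto simp: del_pair_def fun_eq_iff nth_append Suc_diff_le)

text \<open>Stage \<open>i\<close> equals \<open>t\<close> after cancelling any equal pair at a position \<open>j \<le> i\<close>.\<close>

primrec catalan_stage ::
    "('a \<Rightarrow> 'a \<Rightarrow> 'a \<Rightarrow> 'a) \<Rightarrow> ((nat \<Rightarrow> 'a) \<Rightarrow> 'a) \<Rightarrow> nat \<Rightarrow> (nat \<Rightarrow> 'a) \<Rightarrow> 'a" where
  "catalan_stage \<phi> t 0 x = t (del_pair 0 x)"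
| "catalan_stage \<phi> t (Suc i) x =
     \<phi> (catalan_stage \<phi> t i x) (catalan_stage \<phi> t i (x(i + 2 := x (i + 1))))
       (t (del_pair (i + 1) x))"

text \<open>\<open>catalan \<phi> k\<close> has arity \<open>2 * k + 1\<close>: only \<open>x 0, \<dots>, x (2 * k)\<close> matter.\<close>

primrec catalan :: "('a \<Rightarrow> 'a \<Rightarrow> 'a \<Rightarrow> 'a) \<Rightarrow> nat \<Rightarrow> (nat \<Rightarrow> 'a) \<Rightarrow> 'a" where
  "catalan \<phi> 0 x = x 0"
| "catalan \<phi> (Suc k) x = catalan_stage \<phi> (catalan \<phi> k) (2 * k + 1) x"

text \<open>In the last step of a stage, either the pair sits at the newest position and the first
  two arguments of \<open>\<phi>\<close> agree, or it sits earlier and the last two agree. The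
  Mal'tsev identities then leave the required value. The assumption on \<open>t\<close> says that,
  of two disjoint equal pairs, either may be cancelled first.\<close>

lemma catalan_stage_cancel:
  assumes maltsev: "\<And>a b. \<phi> a a b = b" "\<And>a b. \<phi> b a a = b"
    and t: "\<And>x i j. j + 2 \<le> i \<Longrightarrow> i \<le> m \<Longrightarrow> x j = x (j + 1) \<Longrightarrow> x i = x (i + 1) \<Longrightarrow>
              t (del_pair i x) = t (del_pair j x)"
    and "i \<le> m" "j \<le> i" "x j = x (j + 1)"
  shows "catalan_stage \<phi> t i x = t (del_pair j x)"
  using assms(4-)
proof (induction i arbitrary: j x)
  case (Suc i)
  let ?x = "x(i + 2 := x (i + 1))"
  show ?case
  proof (cases "j = Suc i")
    case True
    then have "?x = x"
      using Suc.prems by (auto simp: fun_eq_iff)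
    then show ?thesis
      using True maltsev by simp
  next
    case False
    then have j: "j \<le> i"
      using Suc.prems by simp
    have "catalan_stage \<phi> t i x = t (del_pair j x)"
      using Suc j by simp
    moreover have "catalan_stage \<phi> t i ?x = t (del_pair j ?x)"
      using Suc j by simp
    moreover have "t (del_pair j ?x) = t (del_pair (i + 1) x)"
    \<comment> \<open>For \<open>j = i\<close> the entries of \<open>?x\<close> at \<open>i\<close>,
      \<open>i + 1\<close>, \<open>i + 2\<close> coincide, so deleting at \<open>i\<close> or at
      \<open>i + 1\<close> gives the same sequence. For \<open>j < i\<close> the pairs of
      \<open>?x\<close> at \<open>j\<close> and \<open>i + 1\<close> are disjoint, and deleting the
      latter removes the altered entry.\<close>
    proof (cases "j = i")
      case True
      then have "del_pair j ?x = del_pair (i + 1) x"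
        using Suc.prems by (auto simp: del_pair_def fun_eq_iff less_Suc_eq)
      then show ?thesis by simp
    next
      case False
      then have "t (del_pair (i + 1) ?x) = t (del_pair j ?x)"
        using j Suc.prems by (intro t) auto
      moreover have "del_pair (i + 1) ?x = del_pair (i + 1) x"
        by (auto simp: del_pair_def fun_eq_iff)
      ultimately show ?thesis by simp
    qed
    ultimately show ?thesis
      using maltsev by simp
  qed
qed simp

text \<open>Induction on the arity. For two disjoint equal pairs, cancelling either one and then, by
  induction, the other leads to the same sequence; this is the compatibility that the stages
  require.\<close>

lemma catalan_cancel:
  assumes maltsev: "\<And>a b. \<phi> a a b = b" "\<And>a b. \<phi> b a a = b"
    and "j \<le> 2 * k + 1" "x j = x (j + 1)"
  shows "catalan \<phi> (Suc k) x = catalan \<phi> k (del_pair j x)"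
  using assms(3-)
proof (induction k arbitrary: j x)
  case 0
  show ?case
    unfolding catalan.simps(2)
    \<comment> \<open>Positions up to 1 leave no room for two disjoint pairs, so the compatibility
      condition is vacuous.\<close>
    by (rule catalan_stage_cancel[OF maltsev, where m = 1]) (use 0 in auto)
next
  case (Suc k)
  have "catalan \<phi> (Suc k) (del_pair i x) = catalan \<phi> (Suc k) (del_pair j x)"
    if ij: "j + 2 \<le> i" "i \<le> 2 * Suc k + 1" "x j = x (j + 1)" "x i = x (i + 1)" for x i j
  proof -
    have "catalan \<phi> (Suc k) (del_pair i x) = catalan \<phi> k (del_pair j (del_pair i x))"
      using ij by (intro Suc.IH) (auto simp: del_pair_def)
    also have "\<dots> = catalan \<phi> k (del_pair (i - 2) (del_pair j x))"
      using ij by (simp only: del_pair_commute)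
    also have "\<dots> = catalan \<phi> (Suc k) (del_pair j x)"
      using ij by (intro Suc.IH[symmetric]) (auto simp: del_pair_def numeral_2_eq_2 Suc_diff_Suc)
    finally show ?thesis .
  qed
  then show ?case
    unfolding catalan.simps(2)[of \<phi> "Suc k"] using Suc.prems
    by (intro catalan_stage_cancel[where m = "2 * Suc k + 1"] maltsev) auto
qed

text \<open>A stage is composed of \<open>\<phi>\<close> and \<open>t\<close>, so it preserves
  \<open>A\<close> when both do. Here \<open>t\<close> reads the arguments 0 to \<open>m\<close>,
  and the stages read 0 to \<open>m + 2\<close>.\<close>

lemma catalan_stage_closed:
  assumes \<phi>: "\<And>x y z. x \<in> A \<Longrightarrow> y \<in> A \<Longrightarrow> z \<in> A \<Longrightarrow> (\<lambda>i\<in>I. \<phi> (x i) (y i) (z i)) \<in> A"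
    and t: "\<And>p. (\<And>n. n \<le> m \<Longrightarrow> p n \<in> A) \<Longrightarrow> (\<lambda>i\<in>I. t (\<lambda>n. p n i)) \<in> A"
    and "k \<le> m + 1" "\<And>n. n \<le> m + 2 \<Longrightarrow> p n \<in> A"
  shows "(\<lambda>i\<in>I. catalan_stage \<phi> t k (\<lambda>n. p n i)) \<in> A"
  using assms(3-)
proof (induction k arbitrary: p)
  case 0
  have "(\<lambda>n. del_pair 0 p n i) = del_pair 0 (\<lambda>n. p n i)" for i
    by (auto simp: del_pair_def)
  moreover have "(\<lambda>i\<in>I. t (\<lambda>n. del_pair 0 p n i)) \<in> A"
    by (rule t) (simp add: del_pair_def 0)
  ultimately show ?case
    by (simp only: catalan_stage.simps)
next
  case (Suc k)
  let ?p = "p(k + 2 := p (k + 1))"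
  have a: "(\<lambda>i\<in>I. catalan_stage \<phi> t k (\<lambda>n. p n i)) \<in> A"
    using Suc.prems by (intro Suc.IH) auto
  have b: "(\<lambda>i\<in>I. catalan_stage \<phi> t k (\<lambda>n. ?p n i)) \<in> A"
    using Suc.prems by (intro Suc.IH) auto
  have c: "(\<lambda>i\<in>I. t (\<lambda>n. del_pair (k + 1) p n i)) \<in> A"
    by (rule t) (use Suc.prems in \<open>auto simp: del_pair_def\<close>)
  have upd: "(\<lambda>n. ?p n i) = (\<lambda>n. p n i)(k + 2 := p (k + 1) i)" for i
    by auto
  have del: "(\<lambda>n. del_pair (k + 1) p n i) = del_pair (k + 1) (\<lambda>n. p n i)" for i
    by (auto simp: del_pair_def)
  have "(\<lambda>i\<in>I. catalan_stage \<phi> t (Suc k) (\<lambda>n. p n i)) =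
      (\<lambda>i\<in>I. \<phi> ((\<lambda>i\<in>I. catalan_stage \<phi> t k (\<lambda>n. p n i)) i)
        ((\<lambda>i\<in>I. catalan_stage \<phi> t k (\<lambda>n. ?p n i)) i)
        ((\<lambda>i\<in>I. t (\<lambda>n. del_pair (k + 1) p n i)) i))"
    by (rule restrict_ext) (simp only: catalan_stage.simps restrict_apply' upd del)
  then show ?case
    using \<phi>[OF a b c] by (simp only:)
qed

lemma catalan_closed:
  assumes \<phi>: "\<And>x y z. x \<in> A \<Longrightarrow> y \<in> A \<Longrightarrow> z \<in> A \<Longrightarrow> (\<lambda>i\<in>I. \<phi> (x i) (y i) (z i)) \<in> A"
    and A: "A \<subseteq> extensional I"
    and p: "\<And>n. n \<le> 2 * k \<Longrightarrow> p n \<in> A"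
  shows "(\<lambda>i\<in>I. catalan \<phi> k (\<lambda>n. p n i)) \<in> A"
  using p
proof (induction k arbitrary: p)
  case 0
  then have "restrict (p 0) I = p 0"
    using A by (intro extensional_restrict) auto
  then show ?case
    using 0 by simp
next
  case (Suc k)
  show ?case
    unfolding catalan.simps(2)
    by (rule catalan_stage_closed[OF \<phi> Suc.IH]) (use Suc.prems in auto)
qed

section \<open>Alternating sums\<close>

fun altsum :: "'a::ab_group_add list \<Rightarrow> 'a" where
  "altsum [] = 0"
| "altsum (x # xs) = x - altsum xs"

lemma altsum_append:
  "altsum (xs @ ys) = altsum xs + (if even (length xs) then altsum ys else - altsum ys)"
  by (induction xs) auto

lemma altsum_rev: "altsum (rev xs) = (if even (length xs) then - altsum xs else altsum xs)"
  by (induction xs) (auto simp: altsum_append)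

text \<open>In an alternating Boolean word all ones stand at positions of one parity, hence carry
  one sign, and the sum is their number up to sign.\<close>

lemma altsum_alternating:
  fixes x :: int
  assumes "distinct_adj (x # xs)" "set (x # xs) \<subseteq> {0, 1}"
  shows "altsum (x # xs) =
    (if x = 1 then int (length xs div 2) + 1 else - int (Suc (length xs) div 2))"
  using assms
proof (induction xs arbitrary: x)
  case (Cons y ys)
  then show ?case
    using Cons.IH[of y] by auto
qed auto

lemma not_distinct_adjE:
  assumes "\<not> distinct_adj xs"
  obtains u a v where "xs = u @ a # a # v"
  using assms
proof (induction xs arbitrary: thesis)
  case (Cons x xs)
  show ?case
  proof (cases "distinct_adj xs")
    case True
    then obtain ys where "xs = x # ys"
      using Cons.prems(2) by (cases xs) auto
    then show ?thesis
      using Cons.prems(1)[of "[]" x ys] by simp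
  next
    case False
    then obtain u a v where "xs = u @ a # a # v"
      using Cons.IH by blast
    then show ?thesis
      using Cons.prems(1)[of "x # u" a v] by simp
  qed
qed simp

text \<open>Cancelling an equal pair changes neither side, which reduces the word to a single
  letter. The map \<open>h\<close> reads letters off arbitrary objects, later tuples at a fixed
  coordinate, and \<open>f\<close> carries them into the domain of \<open>\<phi>\<close>.\<close>

lemma catalan_altsum:
  fixes h :: "'b \<Rightarrow> int"
  assumes maltsev: "\<And>a b. \<phi> a a b = b" "\<And>a b. \<phi> b a a = b"
    and "length xs = 2 * k + 1" "h ` set xs \<subseteq> {0, 1}" "altsum (map h xs) \<in> {0, 1}"
  shows "catalan \<phi> k (\<lambda>n. f (h (xs ! n))) = f (altsum (map h xs))"
  using assms(3-)
proof (induction k arbitrary: xs)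
  case 0
  then show ?case by (auto simp: length_Suc_conv)
next
  case (Suc k)
  have "\<not> distinct_adj (map h xs)"
  proof
    assume adj: "distinct_adj (map h xs)"
    obtain y ys where "xs = y # ys" "length ys = 2 * Suc k"
      using Suc.prems(1) by (cases xs) auto
    \<comment> \<open>An alternating word of length \<open>2 * k + 3\<close> has sum
      \<open>k + 2\<close> or \<open>- (k + 1)\<close>, neither of them 0 or 1.\<close>
    then show False
      using altsum_alternating[of "h y" "map h ys"] adj Suc.prems(2,3) by (auto split: if_splits)
  qed
  then obtain u' c v' where "map h xs = u' @ c # c # v'"
    by (rule not_distinct_adjE)
  then obtain u a b v where xs: "xs = u @ a # b # v" and ab: "h a = h b"
    by (auto simp: map_eq_append_conv map_eq_Cons_conv)
  have "catalan \<phi> (Suc k) (\<lambda>n. f (h (xs ! n))) =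
      catalan \<phi> k (del_pair (length u) (\<lambda>n. f (h (xs ! n))))"
    using Suc.prems(1) by (intro catalan_cancel maltsev) (auto simp: xs ab nth_append)
  also have "\<dots> = catalan \<phi> k (\<lambda>n. f (h ((u @ v) ! n)))"
    unfolding xs del_pair_nth[of u "\<lambda>p. f (h p)"] ..
  also have "\<dots> = f (altsum (map h (u @ v)))"
    using Suc.prems by (intro Suc.IH) (auto simp: xs ab altsum_append)
  also have "altsum (map h (u @ v)) = altsum (map h xs)"
    by (simp add: xs ab altsum_append)
  finally show ?case .
qed

text \<open>Apply the cancellation term to the images of \<open>ps\<close> under
  \<open>\<sigma>\<close>: the result lies in \<open>A\<close> and equals the image of
  \<open>x\<close> coordinatewise. The embedding pulls it back to \<open>P\<close>.\<close>

lemma maltsev_altsum_closed: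
  assumes P: "P \<subseteq> tuples r {0, 1}" and A: "A \<subseteq> tuples r D"
    and maltsev: "maltsev_polymorphism r D A \<phi>" and emb: "embeds r P D A"
    and ps: "set ps \<subseteq> P" "odd (length ps)"
    and x: "x \<in> tuples r {0, 1}" "\<And>i. i < r \<Longrightarrow> int (x i) = altsum (map (\<lambda>p. int (p i)) ps)"
  shows "x \<in> P"
proof -
  obtain \<sigma> where \<sigma>: "\<sigma> \<in> {0, 1} \<rightarrow> D" "inj_on \<sigma> {0, 1}"
      "compose {..<r} \<sigma> ` P = A \<inter> tuples r (\<sigma> ` {0, 1})"
    using emb unfolding embeds_def by blast
  \<comment> \<open>extending \<open>\<phi>\<close> so that its identities hold on the whole type\<close>
  define \<psi> where "\<psi> a b c =
    (if a \<in> D \<and> b \<in> D \<and> c \<in> D then \<phi> a b c else if a = b then c else a)" for a b c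
  have \<psi>: "\<psi> a a b = b" "\<psi> b a a = b" for a b
    using maltsev by (auto simp: \<psi>_def maltsev_polymorphism_def)
  have closed: "(\<lambda>i\<in>{..<r}. \<psi> (u i) (v i) (w i)) \<in> A" if "u \<in> A" "v \<in> A" "w \<in> A" for u v w
  proof -
    have "u i \<in> D" "v i \<in> D" "w i \<in> D" if "i < r" for i
      using A \<open>u \<in> A\<close> \<open>v \<in> A\<close> \<open>w \<in> A\<close> that by (meson PiE_mem lessThan_iff subsetD)+
    then have "(\<lambda>i\<in>{..<r}. \<psi> (u i) (v i) (w i)) = (\<lambda>i\<in>{..<r}. \<phi> (u i) (v i) (w i))"
      by (auto simp: \<psi>_def intro!: restrict_ext)
    then show ?thesis
      using maltsev that by (simp add: maltsev_polymorphism_def)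
  qed
  obtain k where k: "length ps = 2 * k + 1"
    using ps(2) by (auto elim: oddE)
  have "compose {..<r} \<sigma> (ps ! n) \<in> A" if "n \<le> 2 * k" for n
    using \<sigma>(3) ps(1) k that by (metis IntD1 image_eqI le_imp_less_Suc nth_mem subsetD Suc_eq_plus1)
  then have "(\<lambda>i\<in>{..<r}. catalan \<psi> k (\<lambda>n. compose {..<r} \<sigma> (ps ! n) i)) \<in> A"
    using A by (intro catalan_closed closed) (auto simp: PiE_def)
  also have "(\<lambda>i\<in>{..<r}. catalan \<psi> k (\<lambda>n. compose {..<r} \<sigma> (ps ! n) i)) = compose {..<r} \<sigma> x"
  proof -
    have "catalan \<psi> k (\<lambda>n. compose {..<r} \<sigma> (ps ! n) i) = \<sigma> (x i)" if i: "i < r" for i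
    proof -
      have "p i \<in> {0, 1}" if "p \<in> P" for p
        using P i that by blast
      then have "(\<lambda>p. int (p i)) ` set ps \<subseteq> {0, 1}"
        using ps(1) by fastforce
      moreover have "x i \<in> {0, 1}"
        using x(1) i by blast
      then have "altsum (map (\<lambda>p. int (p i)) ps) \<in> {0, 1}"
        by (auto simp flip: x(2)[OF i])
      \<comment> \<open>Sums are formed in the integers; \<open>\<sigma> (nat y)\<close> turns the
        letter \<open>y\<close> back into an element of \<open>D\<close>.\<close>
      ultimately show ?thesis
        using catalan_altsum[OF \<psi> k, of "\<lambda>p. int (p i)" "\<lambda>y. \<sigma> (nat y)"] i
        by (simp add: compose_def flip: x(2)[OF i])
    qed
    then show ?thesis
      by (auto simp: compose_def intro!: restrict_ext)
  qed
  finally have "compose {..<r} \<sigma> x \<in> A" .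
  moreover have "compose {..<r} \<sigma> x \<in> tuples r (\<sigma> ` {0, 1})"
  proof (rule PiE_I)
    fix i assume i: "i \<in> {..<r}"
    show "compose {..<r} \<sigma> x i \<in> \<sigma> ` {0, 1}"
      using PiE_mem[OF x(1) i] i by (simp only: compose_eq imageI)
  qed (simp add: compose_def)
  ultimately obtain p where p: "p \<in> P" "compose {..<r} \<sigma> x = compose {..<r} \<sigma> p"
    using \<sigma>(3) by blast
  have "x = p"
  proof (rule PiE_ext[OF x(1)])
    show "p \<in> tuples r {0, 1}"
      using P p(1) by blast
    fix i assume i: "i \<in> {..<r}"
    then have "\<sigma> (x i) = \<sigma> (p i)"
      using fun_cong[OF p(2), of i] by (simp add: compose_def)
    then show "x i = p i"
      by (rule inj_onD[OF \<sigma>(2) _ PiE_mem[OF x(1) i] PiE_mem[OF subsetD[OF P p(1)] i]])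
  qed
  then show ?thesis
    using p(1) by simp
qed

section \<open>Separation modulo N\<close>

text \<open>
  Induction on the number of coordinates. If \<open>g > 0\<close> is the gcd of the coordinates at \<open>a\<close> and
  divides \<open>x a\<close>, the problem passes to the sublattice vanishing at \<open>a\<close>, and a modulus \<open>N\<close>
  obtained there gives the modulus \<open>g * N\<close>.
\<close>

lemma subgroup_separable_mod:
  fixes L :: "('i \<Rightarrow> int) set"
  assumes "finite S" "(\<lambda>_. 0) \<in> L" "\<And>u v. u \<in> L \<Longrightarrow> v \<in> L \<Longrightarrow> (\<lambda>i. u i - v i) \<in> L"
    and "\<And>l. l \<in> L \<Longrightarrow> \<exists>i\<in>S. x i \<noteq> l i"
  shows "\<exists>N::nat. N > 0 \<and> (\<forall>l\<in>L. \<exists>i\<in>S. \<not> int N dvd x i - l i)"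
  using assms
proof (induction S arbitrary: L x rule: finite_induct)
  case empty
  then show ?case by blast
next
  case (insert a S)
  note zero = insert.prems(1) and diff = insert.prems(2) and sep = insert.prems(3)
  have neg: "(\<lambda>i. - u i) \<in> L" if "u \<in> L" for u
    using diff[OF zero that] by simp
  have add: "(\<lambda>i. u i + v i) \<in> L" if "u \<in> L" "v \<in> L" for u v
    using diff[OF that(1) neg[OF that(2)]] by simp
  have nat_mult: "(\<lambda>i. int n * u i) \<in> L" if "u \<in> L" for u n
    using that by (induction n) (auto simp: zero distrib_right intro: add)
  have mult: "(\<lambda>i. c * u i) \<in> L" if "u \<in> L" for u c
    using nat_mult[OF that, of "nat \<bar>c\<bar>"] neg[OF nat_mult[OF that, of "nat \<bar>c\<bar>"]]
    by (cases "c \<ge> 0") auto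
  show ?case
  proof (cases "\<forall>l\<in>L. l a = 0")
    case all0: True
    show ?thesis
    proof (cases "x a = 0")
      case True
      then have "\<And>l. l \<in> L \<Longrightarrow> \<exists>i\<in>S. x i \<noteq> l i"
        using sep all0 by force
      from insert.IH[OF zero diff this] show ?thesis
        by blast
    next
      case False
      \<comment> \<open>A modulus larger than the nonzero \<open>\<bar>x a\<bar>\<close> separates
        at coordinate \<open>a\<close> alone.\<close>
      have "\<not> int (nat \<bar>x a\<bar> + 1) dvd x a"
        using False zdvd_not_zless[of "\<bar>x a\<bar>" "\<bar>x a\<bar> + 1"] by (simp add: add.commute)
      then show ?thesis
        using all0 by (intro exI[of _ "nat \<bar>x a\<bar> + 1"]) force
    qed
  next
    case False
    \<comment> \<open>The values at \<open>a\<close> form a nonzero subgroup of the integers,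
      generated by its least positive element \<open>g\<close>.\<close>
    define Q where "Q n \<longleftrightarrow> n > 0 \<and> (\<exists>l\<in>L. l a = int n)" for n
    define g where "g = (LEAST n. Q n)"
    obtain l0 where l0: "l0 \<in> L" "l0 a \<noteq> 0"
      using False by blast
    then have "Q (nat \<bar>l0 a\<bar>)"
      using bexI[OF _ l0(1), of "\<lambda>l. l a = \<bar>l0 a\<bar>"]
        bexI[OF _ neg[OF l0(1)], of "\<lambda>l. l a = \<bar>l0 a\<bar>"]
      unfolding Q_def by (cases "l0 a > 0") auto
    then have "Q g"
      unfolding g_def by (rule LeastI)
    then obtain d where g: "g > 0" and d: "d \<in> L" "d a = int g"
      unfolding Q_def by blast
    have dvd: "int g dvd l a" if "l \<in> L" for l
    proof (rule ccontr)
      assume "\<not> int g dvd l a"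
      then have "l a mod int g \<noteq> 0"
        by (simp add: mod_eq_0_iff_dvd)
      moreover have "l a mod int g \<ge> 0"
        using g by simp
      ultimately have pos: "l a mod int g > 0"
        by linarith
      have "\<exists>u\<in>L. u a = l a mod int g"
        by (rule bexI[OF _ diff[OF that mult[OF d(1), of "l a div int g"]]])
          (simp add: d(2) minus_div_mult_eq_mod)
      then have "Q (nat (l a mod int g))"
        using pos unfolding Q_def by simp
      then have "g \<le> nat (l a mod int g)"
        unfolding g_def by (rule Least_le)
      moreover have "l a mod int g < int g"
        using g by simp
      ultimately show False
        using pos by linarith
    qed
    show ?thesis
    proof (cases "int g dvd x a")
      case False
      then have "\<not> int g dvd x a - l a" if "l \<in> L" for l
        using dvd[OF that] that by (simp add: dvd_diff_left_iff)
      then show ?thesis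
        using g by blast
    next
      case True
      then obtain c where c: "x a = int g * c" ..
      \<comment> \<open>Shifting \<open>x\<close> by a lattice vector makes it vanish at
        \<open>a\<close>, so it can be compared with \<open>L'\<close> on \<open>S\<close>
        alone.\<close>
      define y where "y i = x i - c * d i" for i
      define L' where "L' = {l \<in> L. l a = 0}"
      have "\<exists>i\<in>S. y i \<noteq> l i" if "l \<in> L'" for l
      proof -
        have "(\<lambda>i. l i + c * d i) \<in> L"
          using that add[OF _ mult[OF d(1)]] unfolding L'_def by blast
        from sep[OF this] show ?thesis
          using that c d(2) by (force simp: y_def L'_def)
      qed
      moreover have "(\<lambda>_. 0) \<in> L'" "\<And>u v. u \<in> L' \<Longrightarrow> v \<in> L' \<Longrightarrow> (\<lambda>i. u i - v i) \<in> L'"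
        using zero diff by (auto simp: L'_def)
      ultimately obtain N :: nat where N: "N > 0" "\<forall>l\<in>L'. \<exists>i\<in>S. \<not> int N dvd y i - l i"
        using insert.IH[of L' y] by blast
      have "\<exists>i\<in>insert a S. \<not> int (g * N) dvd x i - l i" if l: "l \<in> L" for l
      proof (rule ccontr)
        assume "\<not> ?thesis"
        then have all: "int g * int N dvd x i - l i" if "i \<in> insert a S" for i
          using that by auto
        obtain z where z: "x a - l a = int g * int N * z"
          using all[of a] by blast
        \<comment> \<open>Since \<open>l a = int g * (c - int N * z)\<close>, subtracting this
          multiple of \<open>d\<close> lands in \<open>L'\<close>, and \<open>y - l'\<close> differs
          from \<open>x - l\<close> only by a multiple of \<open>N\<close>.\<close>
        define l' where "l' i = l i - (c - int N * z) * d i" for i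
        have "l' \<in> L'"
          using diff[OF l mult[OF d(1), of "c - int N * z"]] d(2) c z
          unfolding L'_def l'_def by (auto simp: algebra_simps)
        then obtain i where i: "i \<in> S" "\<not> int N dvd y i - l' i"
          using N(2) by blast
        have "y i - l' i = (x i - l i) - int N * (z * d i)"
          by (simp add: y_def l'_def algebra_simps)
        moreover have "int N dvd x i - l i"
          using all[of i] i(1) by (meson dvd_mult_right insertI2)
        ultimately show False
          using i(2) by simp
      qed
      then show ?thesis
        using g N(1) by (intro exI[of _ "g * N"]) auto
    qed
  qed
qed

section \<open>Cosets modulo N\<close>

text \<open>The integers modulo \<open>N\<close>, on representatives of type \<open>nat\<close> as
  \<open>embeds_in_finite_abelian_group\<close> demands.\<close>

definition nat_mod_group :: "nat \<Rightarrow> nat monoid" where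
  "nat_mod_group N = \<lparr>carrier = {..<N}, mult = (\<lambda>a b. (a + b) mod N), one = 0\<rparr>"

lemma nat_mod_group_simps [simp]:
  "carrier (nat_mod_group N) = {..<N}"
  "a \<otimes>\<^bsub>nat_mod_group N\<^esub> b = (a + b) mod N"
  "\<one>\<^bsub>nat_mod_group N\<^esub> = 0"
  by (simp_all add: nat_mod_group_def)

lemma comm_group_nat_mod_group:
  assumes "N > 0"
  shows "comm_group (nat_mod_group N)"
proof (rule comm_groupI)
  fix a assume "a \<in> carrier (nat_mod_group N)"
  then show "\<exists>b\<in>carrier (nat_mod_group N). b \<otimes>\<^bsub>nat_mod_group N\<^esub> a = \<one>\<^bsub>nat_mod_group N\<^esub>"
    using assms by (intro bexI[of _ "(N - a) mod N"]) (auto simp: mod_add_left_eq)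
qed (use assms in \<open>auto simp: mod_add_left_eq mod_add_right_eq ac_simps\<close>)

lemma dvd_mod_diff_iff: "n dvd a mod n - b \<longleftrightarrow> n dvd a - b" for n a b :: int
  by (simp flip: mod_eq_dvd_iff)

text \<open>The group is Z/N, the subgroup is the reduction of \<open>L\<close> modulo
  \<open>N\<close>, and the coset is its translate by \<open>b\<close>. As \<open>N \<ge> 2\<close>,
  the letters 0 and 1 embed as themselves. Allowing non-Boolean \<open>b\<close> covers empty
  \<open>P\<close>.\<close>

lemma embeds_in_finite_abelian_group_mod:
  fixes L :: "(nat \<Rightarrow> int) set"
  assumes N: "N \<ge> 2" and zero: "(\<lambda>_. 0) \<in> L"
    and diff: "\<And>u v. u \<in> L \<Longrightarrow> v \<in> L \<Longrightarrow> (\<lambda>i. u i - v i) \<in> L"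
    and b: "b \<in> tuples r {..<N}"
    and P: "P = {x \<in> tuples r {0, 1}. \<exists>l\<in>L. \<forall>i<r. int N dvd int (x i) - int (b i) - l i}"
  shows "embeds_in_finite_abelian_group r P"
proof -
  let ?G = "nat_mod_group N"
  let ?GG = "product_group {..<r} (\<lambda>_. ?G)"
  interpret G: comm_group ?G
    using N by (intro comm_group_nat_mod_group) simp
  interpret GG: group ?GG
    by (simp add: G.is_group)
  define H where "H = {h \<in> tuples r {..<N}. \<exists>l\<in>L. \<forall>i<r. int N dvd int (h i) - l i}"
  have b_carrier: "b \<in> carrier ?GG"
    using b by simp
  have "subgroup H ?GG"
  proof (rule GG.subgroupI)
    show "H \<subseteq> carrier ?GG"
      by (auto simp: H_def)
    have "(\<lambda>i\<in>{..<r}. 0) \<in> H"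
      using N zero by (auto simp: H_def intro!: bexI[of _ "\<lambda>_. 0"])
    then show "H \<noteq> {}" by blast
  next
    fix h assume h: "h \<in> H"
    then obtain l where l: "l \<in> L" "\<And>i. i < r \<Longrightarrow> int N dvd int (h i) - l i"
      by (auto simp: H_def)
    have inv: "inv\<^bsub>?G\<^esub> a = (N - a) mod N" if "a < N" for a
      using that N by (intro G.inv_equality) (auto simp: mod_add_left_eq)
    have hN: "h i < N" if "i < r" for i
      using h that by (auto simp: H_def)
    have "inv\<^bsub>?GG\<^esub> h = (\<lambda>i\<in>{..<r}. inv\<^bsub>?G\<^esub> h i)"
      using h by (intro inv_product_group) (auto simp: H_def G.is_group)
    also have "\<dots> = (\<lambda>i\<in>{..<r}. (N - h i) mod N)"
      using hN by (auto intro!: restrict_ext inv)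
    finally have inv_h: "inv\<^bsub>?GG\<^esub> h = (\<lambda>i\<in>{..<r}. (N - h i) mod N)" .
    have "int N dvd int ((N - h i) mod N) - (0 - l i)" if "i < r" for i
    proof -
      have "int N dvd int N - (int (h i) - l i)"
        by (rule dvd_diff[OF dvd_refl l(2)[OF that]])
      then show ?thesis
        using hN[OF that]
        by (simp only: zmod_int dvd_mod_diff_iff of_nat_diff less_imp_le) (simp add: algebra_simps)
    qed
    then show "inv\<^bsub>?GG\<^esub> h \<in> H"
      using N unfolding inv_h H_def by (auto intro!: bexI[OF _ diff[OF zero l(1)]])
  next
    fix h h' assume h: "h \<in> H" "h' \<in> H"
    then obtain l l' where l: "l \<in> L" "\<And>i. i < r \<Longrightarrow> int N dvd int (h i) - l i"
      "l' \<in> L" "\<And>i. i < r \<Longrightarrow> int N dvd int (h' i) - l' i"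
      by (auto simp: H_def)
    have add: "(\<lambda>i. l i + l' i) \<in> L"
      using diff[OF l(1) diff[OF zero l(3)]] by simp
    have "int N dvd int ((h i + h' i) mod N) - (l i + l' i)" if "i < r" for i
      using dvd_add[OF l(2,4)[OF that]] by (simp add: zmod_int dvd_mod_diff_iff algebra_simps)
    then show "h \<otimes>\<^bsub>?GG\<^esub> h' \<in> H"
      using N by (auto simp: H_def intro!: bexI[OF _ add])
  qed
  moreover have "H #>\<^bsub>?GG\<^esub> b \<in> rcosets\<^bsub>?GG\<^esub> H"
    using b_carrier GG.rcosetsI H_def by (simp add: Collect_mono)
  moreover have "embeds r P (carrier ?G) (H #>\<^bsub>?GG\<^esub> b)"
    unfolding embeds_def
  proof (intro bexI[of _ id] conjI)
    have "x \<in> P \<longleftrightarrow> x \<in> H #>\<^bsub>?GG\<^esub> b" if x: "x \<in> tuples r {0, 1}" for x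
    proof
      assume "x \<in> H #>\<^bsub>?GG\<^esub> b"
      then obtain h l where h: "h \<in> H" "x = (\<lambda>i\<in>{..<r}. (h i + b i) mod N)"
        and l: "l \<in> L" "\<And>i. i < r \<Longrightarrow> int N dvd int (h i) - l i"
        by (auto simp: r_coset_def H_def)
      have "int N dvd int (x i) - int (b i) - l i" if "i < r" for i
        using l(2)[OF that] that by (simp add: h(2) zmod_int dvd_mod_diff_iff diff_diff_eq)
      then show "x \<in> P"
        using x l(1) unfolding P by blast
    next
      assume "x \<in> P"
      then obtain l where l: "l \<in> L" "\<And>i. i < r \<Longrightarrow> int N dvd int (x i) - int (b i) - l i"
        unfolding P by blast
      \<comment> \<open>The residue of \<open>x - b\<close>, congruent to \<open>l\<close> and hence
        in \<open>H\<close>.\<close>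
      define h where "h = (\<lambda>i\<in>{..<r}. nat ((int (x i) - int (b i)) mod int N))"
      have h_int: "int (h i) = (int (x i) - int (b i)) mod int N" if "i < r" for i
        using that N by (simp add: h_def)
      have "h \<in> tuples r {..<N}"
        using N by (auto simp: h_def nat_less_iff)
      moreover have "int N dvd int (h i) - l i" if "i < r" for i
        using l(2)[OF that] by (simp add: h_int[OF that] dvd_mod_diff_iff)
      ultimately have "h \<in> H"
        using l(1) by (auto simp: H_def)
      moreover have "x = h \<otimes>\<^bsub>?GG\<^esub> b"
      proof
        fix i
        show "x i = (h \<otimes>\<^bsub>?GG\<^esub> b) i"
        proof (cases "i < r")
          case True
          then have "x i \<in> {0, 1}"
            using x by blast
          then have "x i < N"
            using N by auto
          have "int ((h i + b i) mod N) = int (x i) mod int N"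
            by (simp add: zmod_int h_int[OF True] mod_add_left_eq)
          also have "\<dots> = int (x i)"
            using \<open>x i < N\<close> by simp
          finally show ?thesis
            using True by simp
        next
          case False
          then show ?thesis
            using x by (auto simp: PiE_def extensional_def)
        qed
      qed
      ultimately show "x \<in> H #>\<^bsub>?GG\<^esub> b"
        by (auto simp: r_coset_def)
    qed
    moreover have "P \<subseteq> tuples r {0, 1}"
      unfolding P by blast
    ultimately have "(H #>\<^bsub>?GG\<^esub> b) \<inter> tuples r {0, 1} = P"
      by blast
    moreover have "compose {..<r} id ` P = P"
    proof -
      have "compose {..<r} id x = x" if "x \<in> P" for x
        using that unfolding P by (auto simp: compose_def PiE_def intro: extensional_restrict)
      then show ?thesis by simp
    qed
    ultimately show "compose {..<r} id ` P = (H #>\<^bsub>?GG\<^esub> b) \<inter> tuples r (id ` {0, 1})"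
      by (simp only: image_id id_apply)
    show "id \<in> {0, 1} \<rightarrow> carrier ?G"
      using N by auto
  qed simp
  ultimately show ?thesis
    unfolding embeds_in_finite_abelian_group_def
    using G.comm_group_axioms
    by (intro exI[of _ ?G] exI[of _ H] exI[of _ "H #>\<^bsub>?GG\<^esub> b"] conjI) simp_all
qed

section \<open>The affine lattice of \<open>P\<close> and the choice of the modulus\<close>

theorem theorem1p4:
  fixes r :: nat and P :: "(nat \<Rightarrow> nat) set"
    and D :: "'d set" and A :: "(nat \<Rightarrow> 'd) set"
  assumes "r \<ge> 1"
    and "P \<subseteq> tuples r {0, 1}"
    and "A \<subseteq> tuples r D"
    and "\<exists>\<phi>. maltsev_polymorphism r D A \<phi>"
    and "embeds r P D A"
  shows "embeds_in_finite_abelian_group r P"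
proof (cases "P = {}")
  case True
  \<comment> \<open>The trivial subgroup of (Z/3)^r, translated by (2, ..., 2), contains no Boolean
    tuple because there is a coordinate 0.\<close>
  show ?thesis
  proof (rule embeds_in_finite_abelian_group_mod[where N = 3 and L = "{\<lambda>_. 0}"
        and b = "\<lambda>i\<in>{..<r}. 2"])
    have "\<not> 3 dvd int (x 0) - 2" if "x \<in> tuples r {0, 1}" for x
    proof -
      have "x 0 \<in> {0, 1}"
        using assms(1) by (intro PiE_mem[OF that]) simp
      then show ?thesis by auto
    qed
    then show "P = {x \<in> tuples r {0, 1}.
        \<exists>l\<in>{\<lambda>_. 0}. \<forall>i<r. int 3 dvd int (x i) - int ((\<lambda>i\<in>{..<r}. 2) i) - l i}"
      using True assms(1) by (force simp: Suc_le_eq)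
  qed auto
next
  case False
  then obtain b where b: "b \<in> P" by blast
  obtain \<phi> where \<phi>: "maltsev_polymorphism r D A \<phi>"
    using assms(4) by blast
  define s where "s ps i = altsum (map (\<lambda>p. int (p i)) ps)" for ps :: "(nat \<Rightarrow> nat) list" and i
  \<comment> \<open>The group generated by the differences of elements of \<open>P\<close>: the
    direction of its affine lattice.\<close>
  define L where "L = s ` {ps. set ps \<subseteq> P \<and> even (length ps)}"
  have zero: "(\<lambda>_. 0) \<in> L"
    unfolding L_def by (rule image_eqI[of _ _ "[]"]) (auto simp: s_def)
  have diff: "(\<lambda>i. u i - v i) \<in> L" if "u \<in> L" "v \<in> L" for u v
  proof -
    obtain ps where "set ps \<subseteq> P" "even (length ps)" "u = s ps"
      using \<open>u \<in> L\<close> unfolding L_def by blast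
    moreover obtain qs where "set qs \<subseteq> P" "even (length qs)" "v = s qs"
      using \<open>v \<in> L\<close> unfolding L_def by blast
    \<comment> \<open>Reversing a list of even length negates its alternating sum.\<close>
    ultimately show ?thesis
      unfolding L_def
      by (intro image_eqI[of _ _ "ps @ rev qs"])
        (auto simp: s_def altsum_append altsum_rev simp flip: rev_map)
  qed
  have lattice: "x \<in> P"
    if x: "x \<in> tuples r {0, 1}" and l: "l \<in> L" "\<And>i. i < r \<Longrightarrow> int (x i) - int (b i) = l i" for x l
  proof -
    \<comment> \<open>Prepending \<open>b\<close> flips the sign of the remaining sum, so
      \<open>- l\<close> is what has to be represented.\<close>
    have "(\<lambda>i. 0 - l i) \<in> L"
      by (rule diff[OF zero l(1)])
    then obtain ps where ps: "set ps \<subseteq> P" "even (length ps)" "(\<lambda>i. 0 - l i) = s ps"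
      unfolding L_def by blast
    show ?thesis
    proof (rule maltsev_altsum_closed[OF assms(2,3) \<phi> assms(5) _ _ x])
      show "set (b # ps) \<subseteq> P" "odd (length (b # ps))"
        using ps b by auto
      show "int (x i) = altsum (map (\<lambda>p. int (p i)) (b # ps))" if "i < r" for i
        using l(2)[OF that] fun_cong[OF ps(3), of i] by (simp add: s_def)
    qed
  qed
  let ?X = "tuples r {0, 1} - P"
  have "\<exists>N::nat. N > 0 \<and> (\<forall>l\<in>L. \<exists>i\<in>{..<r}. \<not> int N dvd int (x i) - int (b i) - l i)"
    if "x \<in> ?X" for x
    using lattice that by (intro subgroup_separable_mod zero diff) (auto, blast)
  then obtain f :: "(nat \<Rightarrow> nat) \<Rightarrow> nat" where f: "\<And>x. x \<in> ?X \<Longrightarrow> f x > 0"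
    "\<And>x l. x \<in> ?X \<Longrightarrow> l \<in> L \<Longrightarrow> \<exists>i\<in>{..<r}. \<not> int (f x) dvd int (x i) - int (b i) - l i"
    by metis
  \<comment> \<open>A common multiple of the moduli for the finitely many excluded tuples; the
    factor 2 keeps \<open>N \<ge> 2\<close> even if there are none.\<close>
  define N where "N = 2 * prod f ?X"
  have fin: "finite ?X"
    by (intro finite_Diff finite_PiE) auto
  have "prod f ?X > 0"
    using f(1) by (intro prod_pos) auto
  then have N2: "N \<ge> 2"
    by (simp add: N_def)
  show ?thesis
  proof (rule embeds_in_finite_abelian_group_mod[OF N2 zero diff])
    have "tuples r {0, 1} \<subseteq> tuples r {..<N}"
      using N2 by (intro PiE_mono) auto
    then show "b \<in> tuples r {..<N}"
      using b assms(2) by blast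
    show "P = {x \<in> tuples r {0, 1}. \<exists>l\<in>L. \<forall>i<r. int N dvd int (x i) - int (b i) - l i}"
    proof (intro equalityI subsetI)
      fix x assume "x \<in> P"
      then have "s [x, b] \<in> L"
        using b unfolding L_def by (intro imageI) auto
      then show "x \<in> {x \<in> tuples r {0, 1}. \<exists>l\<in>L. \<forall>i<r. int N dvd int (x i) - int (b i) - l i}"
        using subsetD[OF assms(2) \<open>x \<in> P\<close>] by (force simp: s_def intro!: bexI[of _ "s [x, b]"])
    next
      fix x assume "x \<in> {x \<in> tuples r {0, 1}. \<exists>l\<in>L. \<forall>i<r. int N dvd int (x i) - int (b i) - l i}"
      then obtain l where x: "x \<in> tuples r {0, 1}"
        and l: "l \<in> L" "\<And>i. i < r \<Longrightarrow> int N dvd int (x i) - int (b i) - l i"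
        by blast
      show "x \<in> P"
      proof (rule ccontr)
        assume "x \<notin> P"
        then have X: "x \<in> ?X"
          using x by blast
        then have "f x dvd N"
          unfolding N_def using fin by (intro dvd_mult dvd_prodI)
        then have "int (f x) dvd int N"
          by simp
        then show False
          using f(2)[OF X l(1)] l(2) by (meson dvd_trans lessThan_iff)
      qed
    qed
  qed
qed

end
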